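(* For a realization of $\mathbf{\Theta}^*$, define $$\bar\omega:=\max\left\{1-(1-\varepsilon^* )\min_{\mathbf{x}\in V\setminus\{\mathbf{0}\}}\left(\frac{\|\mathbf{x}\|^{\mathbf{\Theta}}_U}{\|\mathbf{x}\|^{\mathbf{\Theta}^*}_U}\right)^2,\ (1+\varepsilon^* )\max_{\mathbf{x}\in V\setminus\{\mathbf{0}\}}\left(\frac{\|\mathbf{x}\|^{\mathbf{\Theta}}_U}{\|\mathbf{x}\|^{\mathbf{\Theta}^*}_U}\right)^2-1\right\}.$$ Then, with probability at least $1-\delta^*$ (over $\mathbf{\Theta}^*$), the following implication holds: if $\bar\omega<1$, then $\mathbf{\Theta}$ is a $U\to\ell_2$ $\bar\omega$-subspace embedding for $V$.
   Context: Let $\mathbb{K}=\mathbb{R}$ or $\mathbb{C}$, $U=\mathbb{K}^n$ with inner product $\langle\cdot,\cdot\rangle_U=\langle\mathbf{R}_U\cdot,\cdot\rangle$ ($\mathbf{R}_U$ symmetric/Hermitian positive definite, $\langle\cdot,\cdot\rangle$ the canonical $\ell_2$-inner product) and norm $\|\cdot\|_U$. For a matrix $\mathbf{\Theta}$ with $n$ columns, $\langle\mathbf{x},\mathbf{y}\rangle^{\mathbf{\Theta}}_U=\langle\mathbf{\Theta}\mathbf{x},\mathbf{\Theta}\mathbf{y}\rangle$ and $\|\mathbf{x}\|^{\mathbf{\Theta}}_U$ is the associated semi-norm. $\mathbf{\Theta}$ is a $U\to\ell_2$ $\varepsilon$-subspace embedding for a subspace $V\subset U$ if $|\langle\mathbf{x},\mathbf{y}\rangle_U-\langle\mathbf{x},\mathbf{y}\rangle^{\mathbf{\Theta}}_U|\le\varepsilon\|\mathbf{x}\|_U\|\mathbf{y}\|_U$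 for all $\mathbf{x},\mathbf{y}\in V$. $V\neq\{\mathbf{0}\}$ is a subspace of $U$, $\mathbf{\Theta}\in\mathbb{K}^{k\times n}$ is a matrix, $0<\varepsilon^*<1$, $0<\delta^*<1$, and $\mathbf{\Theta}^*\in\mathbb{K}^{k^*\times n}$ is a random matrix, generated independently of $\mathbf{\Theta}$ and $V$ (so $\mathbf{\Theta}$ and $V$ may be regarded as fixed), such that for any given vectors $\mathbf{x},\mathbf{y}\in V$ the inequality $|\langle\mathbf{x},\mathbf{y}\rangle_U-\langle\mathbf{x},\mathbf{y}\rangle^{\mathbf{\Theta}^*}_U|\le\varepsilon^*\|\mathbf{x}\|_U\|\mathbf{y}\|_U$ holds with probability at least $1-\delta^*$. Convention: $\bar\omega:=+\infty$ if $\|\mathbf{x}\|^{\mathbf{\Theta}^*}_U=0$ for some $\mathbf{x}\in V\setminus\{\mathbf{0}\}$. *)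

theory Defs
  imports "HOL-Probability.Probability"
begin

text \<open>
  The scalar field \<open>\<real>\<close> or \<open>\<complex>\<close>, with conjugation and real part.  By the
  Gelfand--Mazur theorem a normed field over the reals is isometrically isomorphic to \<open>\<real>\<close>
  or \<open>\<complex>\<close>, and the last two axioms then determine \<open>conjg\<close> and \<open>re\<close>; so the class has, up
  to isomorphism, only the two instances below.
\<close>

class real_or_complex = real_normed_field + euclidean_space +
  fixes conjg :: "'a \<Rightarrow> 'a"
    and re :: "'a \<Rightarrow> real"
  assumes conjg_add: "conjg (x + y) = conjg x + conjg y"
    and conjg_mult: "conjg (x * y) = conjg x * conjg y"
    and mult_conjg_scaleR: "x * conjg x = (norm x)\<^sup>2 *\<^sub>R 1"
    and add_conjg_scaleR: "x + conjg x = (2 * re x) *\<^sub>R 1"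

lemma mult_conjg: "x * conjg x = of_real ((norm x)\<^sup>2)"
  and add_conjg: "x + conjg x = of_real (2 * re x)"
  for x :: "'k::real_or_complex"
  by (simp_all only: of_real_def mult_conjg_scaleR add_conjg_scaleR)

instantiation real :: real_or_complex
begin

definition conjg_real :: "real \<Rightarrow> real" where "conjg_real x = x"
definition re_real :: "real \<Rightarrow> real" where "re_real x = x"

instance
  by standard (simp_all add: conjg_real_def re_real_def power2_eq_square)

end

instantiation complex :: real_or_complex
begin

definition conjg_complex :: "complex \<Rightarrow> complex" where "conjg_complex x = cnj x"
definition re_complex :: "complex \<Rightarrow> real" where "re_complex x = Re x"

instance
proof
  fix x y :: complex
  show "conjg (x + y) = conjg x + conjg y" "conjg (x * y) = conjg x * conjg y"
    by (simp_all add: conjg_complex_def)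
  show "x * conjg x = (norm x)\<^sup>2 *\<^sub>R 1"
    unfolding conjg_complex_def scaleR_conv_of_real by (simp only: complex_norm_square mult_1_right)
  show "x + conjg x = (2 * re x) *\<^sub>R 1"
    unfolding conjg_complex_def re_complex_def scaleR_conv_of_real
    by (simp only: complex_add_cnj mult_1_right)
qed

end

text \<open>
  Inner products are linear in the first argument and conjugate linear in the second.
  All inner products of a vector with itself below are real and nonnegative, so that taking
  the real part under the square root loses nothing.
\<close>

definition cinner :: "'k::real_or_complex ^ 'n \<Rightarrow> 'k ^ 'n \<Rightarrow> 'k" where
  "cinner x y = (\<Sum>i\<in>UNIV. x $ i * conjg (y $ i))"

definition hermitian :: "'k::real_or_complex ^ 'n ^ 'n \<Rightarrow> bool" where
  "hermitian R \<longleftrightarrow> (\<forall>i j. R $ i $ j = conjg (R $ j $ i))"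

definition positive_definite :: "'k::real_or_complex ^ 'n ^ 'n \<Rightarrow> bool" where
  "positive_definite R \<longleftrightarrow> (\<forall>x. x \<noteq> 0 \<longrightarrow> 0 < re (cinner (R *v x) x))"

definition innerU :: "'k::real_or_complex ^ 'n ^ 'n \<Rightarrow> 'k ^ 'n \<Rightarrow> 'k ^ 'n \<Rightarrow> 'k" where
  "innerU R x y = cinner (R *v x) y"

definition normU :: "'k::real_or_complex ^ 'n ^ 'n \<Rightarrow> 'k ^ 'n \<Rightarrow> real" where
  "normU R x = sqrt (re (innerU R x x))"

definition sketched_inner :: "'k::real_or_complex ^ 'n ^ 'm \<Rightarrow> 'k ^ 'n \<Rightarrow> 'k ^ 'n \<Rightarrow> 'k" where
  "sketched_inner \<Theta> x y = cinner (\<Theta> *v x) (\<Theta> *v y)"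

definition sketched_norm :: "'k::real_or_complex ^ 'n ^ 'm \<Rightarrow> 'k ^ 'n \<Rightarrow> real" where
  "sketched_norm \<Theta> x = sqrt (re (sketched_inner \<Theta> x x))"

definition subspace_embedding ::
  "'k::real_or_complex ^ 'n ^ 'n \<Rightarrow> 'k ^ 'n ^ 'm \<Rightarrow> real \<Rightarrow> ('k ^ 'n) set \<Rightarrow> bool" where
  "subspace_embedding R \<Theta> \<epsilon> V \<longleftrightarrow>
     (\<forall>x\<in>V. \<forall>y\<in>V. norm (innerU R x y - sketched_inner \<Theta> x y) \<le> \<epsilon> * normU R x * normU R y)"

text \<open>
  In the finite case the infimum and the supremum range over a bounded set and are attained
  (for a subspace \<open>V \<noteq> {0}\<close>), because the quotient is homogeneous of degree 0 and
  continuous on the compact unit sphere of \<open>V\<close>; see \<open>ratio_attains\<close>.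
\<close>

definition omega_bar ::
  "real \<Rightarrow> 'k::real_or_complex ^ 'n ^ 'm \<Rightarrow> 'k ^ 'n ^ 's \<Rightarrow> ('k ^ 'n) set \<Rightarrow> ereal" where
  "omega_bar \<epsilon> \<Theta> \<Theta>s V =
     (if \<exists>x\<in>V - {0}. sketched_norm \<Theta>s x = 0 then \<infinity>
      else ereal (max
        (1 - (1 - \<epsilon>) * (INF x\<in>V - {0}. (sketched_norm \<Theta> x / sketched_norm \<Theta>s x)\<^sup>2))
        ((1 + \<epsilon>) * (SUP x\<in>V - {0}. (sketched_norm \<Theta> x / sketched_norm \<Theta>s x)\<^sup>2) - 1)))"

lemma sketched_norm_eq: "sketched_norm \<Theta> x = norm (\<Theta> *v x)"
proof -
  have re: "re (of_real r :: 'a) = r" for r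
  proof -
    have *: "conjg (of_real r :: 'a) = of_real r"
      using mult_conjg[of "of_real r :: 'a"] mult_conjg[of "1::'a"] 
      by (cases "r = 0") (auto simp: power2_eq_square conjg_add[of 0 0, simplified])
    show ?thesis using add_conjg[of "of_real r :: 'a"] unfolding *
      by (metis mult_2 mult_left_cancel of_real_add of_real_eq_iff zero_neq_numeral)
  qed
  have "sketched_inner \<Theta> x x = of_real (\<Sum>i\<in>UNIV. (norm ((\<Theta> *v x) $ i))\<^sup>2)"
    by (simp add: sketched_inner_def cinner_def mult_conjg)
  then show ?thesis
    by (simp only: sketched_norm_def re norm_vec_def L2_set_def)
qed

lemma continuous_on_matrix_vector_mult:
  "continuous_on S (\<lambda>x. (\<Theta> :: 'k::real_or_complex ^ 'n ^ 'm) *v x)"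
  unfolding matrix_vector_mult_def
  by (intro continuous_on_vec_lambda continuous_intros)

lemma scaleR_eq_smult: "c *\<^sub>R x = of_real c *s (x :: 'k::real_or_complex ^ 'n)"
  by (simp add: vec_eq_iff) (simp add: scaleR_conv_of_real)

lemma closed_vec_subspace:
  assumes "vec.subspace (V :: ('k::real_or_complex ^ 'n) set)"
  shows "closed V"
proof -
  have "subspace V"
    using assms unfolding subspace_def vec.subspace_def scaleR_eq_smult by simp
  then show ?thesis by (rule closed_subspace)
qed

lemma ratio_attains:
  fixes \<Theta> :: "'k::real_or_complex ^ 'n ^ 'm" and \<Theta>s :: "'k ^ 'n ^ 's"
  assumes V: "vec.subspace V" "V \<noteq> {0}" and nz: "\<forall>x\<in>V - {0}. sketched_norm \<Theta>s x \<noteq> 0"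
  defines "f \<equiv> \<lambda>x. (sketched_norm \<Theta> x / sketched_norm \<Theta>s x)\<^sup>2"
  shows "\<exists>a\<in>V - {0}. \<exists>b\<in>V - {0}. (\<forall>x\<in>V - {0}. f a \<le> f x \<and> f x \<le> f b) \<and>
           (INF x\<in>V - {0}. f x) = f a \<and> (SUP x\<in>V - {0}. f x) = f b"
proof -
  let ?S = "V \<inter> sphere 0 1"
  have hom: "f (of_real c *s x) = f x" if "c \<noteq> 0" for c x
  proof -
    have "norm (A *v (of_real c *s x)) = \<bar>c\<bar> * norm (A *v x)" for A :: "'k ^ 'n ^ 'b::finite"
      by (subst vector_scalar_commute) (simp flip: scaleR_eq_smult)
    from this[of \<Theta>] this[of \<Theta>s] show ?thesis using that
      by (simp add: f_def sketched_norm_eq)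
  qed
  have norm1: "of_real (inverse (norm x)) *s x \<in> ?S" if x: "x \<in> V - {0}" for x
  proof -
    have "norm (of_real (inverse (norm x)) *s x) = 1"
      unfolding scaleR_eq_smult[symmetric] using x by simp
    moreover have "of_real (inverse (norm x)) *s x \<in> V"
      using x V(1) by (simp only: Diff_iff vec.subspace_scale)
    ultimately show ?thesis by simp
  qed
  have "\<exists>x. x \<in> V - {0}" using V vec.subspace_0 by blast
  then have ne: "?S \<noteq> {}" using norm1 by blast
  have cpt: "compact ?S" using closed_vec_subspace[OF V(1)] by (simp add: closed_Int_compact)
  have sub: "?S \<subseteq> V - {0}" by auto
  have cont: "continuous_on ?S f"
    unfolding f_def sketched_norm_eq
    using nz sub unfolding sketched_norm_eq
    by (intro continuous_intros continuous_on_matrix_vector_mult) auto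
  obtain a b where ab: "a \<in> ?S" "b \<in> ?S" "\<forall>x\<in>?S. f a \<le> f x" "\<forall>x\<in>?S. f x \<le> f b"
    using continuous_attains_inf[OF cpt ne cont] continuous_attains_sup[OF cpt ne cont] by blast
  have bnd: "f a \<le> f x \<and> f x \<le> f b" if x: "x \<in> V - {0}" for x
  proof -
    have "f (of_real (inverse (norm x)) *s x) = f x"
      by (rule hom) (use x in simp)
    with ab norm1[OF x] show ?thesis by (metis (lifting))
  qed
  have mem: "a \<in> V - {0}" "b \<in> V - {0}" using ab sub by auto
  have "(INF x\<in>V - {0}. f x) = f a"
    by (rule cInf_eq_minimum) (use bnd mem in auto)
  moreover have "(SUP x\<in>V - {0}. f x) = f b"
    by (rule cSup_eq_maximum) (use bnd mem in auto)
  ultimately show ?thesis using bnd mem by blast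
qed

end

theory Submission
  imports Defs
begin

text \<open>
  The Hermitian form \<open>h x y = \<langle>x, y\<rangle>\<^sub>U - \<langle>\<Theta> x, \<Theta> y\<rangle>\<close> does not depend on the random matrix, so the
  quotient \<open>\<bar>h x x\<bar> / \<parallel>x\<parallel>\<^sub>U\<^sup>2\<close> attains its maximum over \<open>V - {0}\<close> at a fixed vector \<open>a\<close>, and by
  polarization \<open>\<Theta>\<close> is a \<open>c\<close>-embedding exactly when \<open>c\<close> is at least this maximum.  Hence the
  hypothesis is needed only for the single pair \<open>(a, a)\<close>: whenever the random matrix
  preserves the norm of \<open>a\<close> up to \<open>\<epsilon>s\<close>, comparing \<open>\<parallel>\<Theta> a\<parallel>\<close> with \<open>\<parallel>\<Theta>s a\<parallel>\<close> bounds the maximum by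
  \<open>\<omega>\<close>.  The remaining issue is that the event in question is measurable.
\<close>

section \<open>Conjugation and real part, derived from the class axioms\<close>

lemma conjg_0 [simp]: "conjg (0::'k::real_or_complex) = 0"
  using conjg_add[of "0::'k" 0] by simp

lemma conjg_of_real [simp]: "conjg (of_real r :: 'k::real_or_complex) = of_real r"
  using mult_conjg[of "of_real r :: 'k"] by (cases "r = 0") (auto simp: power2_eq_square)

lemma re_of_real [simp]: "re (of_real r :: 'k::real_or_complex) = r"
  using add_conjg[of "of_real r :: 'k"] by (simp flip: of_real_add)

text \<open>The product \<open>x * conjg x\<close> is a real scalar, hence fixed by
  \<open>conjg\<close>; conjugating it and cancelling \<open>conjg x\<close> leaves
  \<open>x\<close>.\<close>

lemma conjg_conjg [simp]: "conjg (conjg x) = (x::'k::real_or_complex)"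
proof (cases "x = 0")
  case False
  have eq: "x * conjg x = of_real ((norm x)\<^sup>2)" by (rule mult_conjg)
  then have "conjg x * conjg (conjg x) = conjg x * x"
    by (metis conjg_mult conjg_of_real mult.commute)
  moreover have "conjg x \<noteq> 0" using eq False by auto
  ultimately show ?thesis by simp
qed simp

text \<open>The axioms give \<open>re\<close> only through \<open>x + conjg x\<close>, so identities
  for it are checked in the field after \<open>of_real\<close> and pulled back by
  injectivity.\<close>

lemma re_add: "re (x + y) = re x + re (y::'k::real_or_complex)"
proof -
  have "of_real (2 * re (x + y)) = (of_real (2 * (re x + re y)) :: 'k)"
    unfolding distrib_left of_real_add add_conjg[symmetric] by (simp add: conjg_add)
  then show ?thesis unfolding of_real_eq_iff by simp
qed

lemma re_0 [simp]: "re (0::'k::real_or_complex) = 0"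
  using re_of_real[of 0, where 'k = 'k] by simp

lemma re_scaleR: "re (c *\<^sub>R x) = c * re (x::'k::real_or_complex)"
proof -
  have "of_real (2 * re (c *\<^sub>R x)) = (of_real (c * (2 * re x)) :: 'k)"
    unfolding of_real_mult[of c] add_conjg[symmetric]
    by (simp add: conjg_mult scaleR_conv_of_real distrib_left)
  then show ?thesis unfolding of_real_eq_iff by simp
qed

lemma linear_re: "linear (re :: 'k::real_or_complex \<Rightarrow> real)"
  by (rule linearI) (simp_all add: re_add re_scaleR)

lemma re_diff: "re (x - y) = re x - re (y::'k::real_or_complex)"
  by (rule linear_diff[OF linear_re])

lemma conjg_diff: "conjg (x - y) = conjg x - conjg (y::'k::real_or_complex)"
  using conjg_add[of "x - y" y] by simp

lemma conjg_sum: "conjg (sum f A) = (\<Sum>i\<in>A. conjg (f i :: 'k::real_or_complex))"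
  by (induction A rule: infinite_finite_induct) (auto simp: conjg_add)

lemma re_conjg [simp]: "re (conjg x) = re (x::'k::real_or_complex)"
proof -
  have "of_real (2 * re (conjg x)) = (of_real (2 * re x) :: 'k)"
    unfolding add_conjg[symmetric] by (simp add: add.commute)
  then show ?thesis unfolding of_real_eq_iff by simp
qed

section \<open>Hermitian sesquilinear forms\<close>

text \<open>Positivity is left out of the axioms so that the difference of two inner products, which
  may be indefinite, is an instance. Conjugate linearity on the right follows from
  \<open>sym\<close>.\<close>

locale hermitian_form =
  fixes h :: "'k::real_or_complex ^ 'n \<Rightarrow> 'k ^ 'n \<Rightarrow> 'k"
  assumes add_left: "h (x + y) z = h x z + h y z"
    and scale_left: "h (c *s x) z = c * h x z"
    and sym: "h y x = conjg (h x y)"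
begin

lemma add_right: "h z (x + y) = h z x + h z y"
  by (metis add_left conjg_add sym)

lemma scale_right: "h z (c *s x) = conjg c * h z x"
  by (metis scale_left conjg_mult sym)

lemma zero_left [simp]: "h 0 x = 0"
  using add_left[of 0 0 x] by simp

lemma zero_right [simp]: "h x 0 = 0"
  using add_right[of x 0 0] by simp

lemma diff_left: "h (x - y) z = h x z - h y z"
  using add_left[of "x - y" y z] by simp

lemma diff_right: "h z (x - y) = h z x - h z y"
  using add_right[of z "x - y" y] by simp

lemma re_sym: "re (h y x) = re (h x y)"
  by (subst sym) simp

lemma diag_real: "h x x = of_real (re (h x x))"
proof -
  have "2 * h x x = of_real (2 * re (h x x))"
    using add_conjg[of "h x x"] unfolding sym[symmetric] mult_2 .
  then show ?thesis by simp
qed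

lemma norm_diag: "norm (h x x) = \<bar>re (h x x)\<bar>"
  by (subst diag_real) simp

lemma diag_scale: "h (c *s x) (c *s x) = of_real ((norm c)\<^sup>2) * h x x"
  unfolding mult_conjg[symmetric] by (simp add: scale_left scale_right mult.assoc)

lemma re_diag_scale: "re (h (c *s x) (c *s x)) = (norm c)\<^sup>2 * re (h x x)"
  by (simp only: diag_scale re_scaleR flip: scaleR_conv_of_real)

lemma polarization: "4 * re (h x y) = re (h (x + y) (x + y)) - re (h (x - y) (x - y))"
  by (simp add: add_left add_right diff_left diff_right re_add re_diff re_sym[of x y])

lemma parallelogram:
  "re (h (x + y) (x + y)) + re (h (x - y) (x - y)) = 2 * (re (h x x) + re (h y y))"
  by (simp add: add_left add_right diff_left diff_right re_add re_diff)

text \<open>Restricted to real scalars the form is bilinear, and bilinear maps in finite dimension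
  are continuous.\<close>

lemma continuous_on_diag: "continuous_on S (\<lambda>x. re (h x x))"
proof -
  have "linear (h x)" "linear (\<lambda>x. h x y)" for x y
    by (rule linearI; simp only: add_left add_right scaleR_eq_smult scale_left scale_right
        conjg_of_real scaleR_conv_of_real)+
  then have "bilinear h" by (simp add: bilinear_def)
  then have "continuous_on S (\<lambda>x. h x x)"
    by (rule bilinear_continuous_on_compose[OF continuous_on_id continuous_on_id])
  then show ?thesis
    by (rule linear_continuous_on_compose[OF _ linear_re])
qed

end

lemma hermitian_form_diff:
  assumes "hermitian_form g" "hermitian_form h"
  shows "hermitian_form (\<lambda>x y. g x y - h x y)"
proof -
  interpret g: hermitian_form g by fact
  interpret h: hermitian_form h by fact
  show ?thesis
  proof
    show "g y x - h y x = conjg (g x y - h x y)" for x y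
      by (simp only: conjg_diff flip: g.sym h.sym)
  qed (simp_all add: g.add_left h.add_left g.scale_left h.scale_left algebra_simps)
qed

section \<open>The two inner products as Hermitian forms, and the bound by polarization\<close>

lemma cinner_sym: "cinner y x = conjg (cinner x y)"
  by (simp add: cinner_def conjg_sum conjg_mult mult.commute)

lemma cinner_add_left: "cinner (x + y) z = cinner x z + cinner y z"
  by (simp add: cinner_def sum.distrib distrib_right)

lemma cinner_scale_left: "cinner (c *s x) z = c * cinner x z"
  by (simp add: cinner_def sum_distrib_left mult.assoc)

lemma hermitian_form_innerU:
  assumes "hermitian R"
  shows "hermitian_form (innerU R)"
proof
  have R: "conjg (R $ i $ j) = R $ j $ i" for i j
    using assms by (metis hermitian_def)
  show "innerU R y x = conjg (innerU R x y)" for x y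
  proof -
    have "innerU R y x = (\<Sum>i\<in>UNIV. \<Sum>j\<in>UNIV. R $ i $ j * y $ j * conjg (x $ i))"
      by (simp add: innerU_def cinner_def matrix_vector_mult_def sum_distrib_right)
    also have "\<dots> = (\<Sum>j\<in>UNIV. \<Sum>i\<in>UNIV. R $ i $ j * y $ j * conjg (x $ i))"
      by (rule sum.swap)
    also have "\<dots> = conjg (innerU R x y)"
      by (simp add: innerU_def cinner_def matrix_vector_mult_def sum_distrib_left conjg_sum
          conjg_mult R mult_ac)
    finally show ?thesis .
  qed
qed (simp_all add: innerU_def matrix_vector_right_distrib vector_scalar_commute
    cinner_add_left cinner_scale_left)

lemma hermitian_form_sketched_inner: "hermitian_form (sketched_inner \<Theta>)"
proof
  show "sketched_inner \<Theta> y x = conjg (sketched_inner \<Theta> x y)" for x y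
    unfolding sketched_inner_def by (rule cinner_sym)
qed (simp_all add: sketched_inner_def matrix_vector_right_distrib vector_scalar_commute
    cinner_add_left cinner_scale_left)

lemma re_sketched_inner: "re (sketched_inner \<Theta> x x) = (sketched_norm \<Theta> x)\<^sup>2"
proof -
  \<comment> \<open>\<open>sqrt\<close> is an odd function on the reals; a nonnegative root
    therefore certifies a nonnegative radicand, and squaring recovers it.\<close>
  have "sqrt (re (sketched_inner \<Theta> x x)) \<ge> 0"
    using sketched_norm_eq[of \<Theta> x] by (simp add: sketched_norm_def)
  then show ?thesis by (simp add: sketched_norm_def)
qed

text \<open>
  Rotating \<open>x\<close> by a unimodular scalar makes \<open>h x y\<close> real, and scaling \<open>x\<close> and \<open>y\<close> to the same
  \<open>g\<close>-norm turns the parallelogram bound into the product bound.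
\<close>

lemma hermitian_form_le:
  assumes h: "hermitian_form h" and g: "hermitian_form g"
    and V: "vec.subspace V" and pos: "\<And>x. x \<noteq> 0 \<Longrightarrow> 0 < re (g x x)"
    and le: "\<And>x. x \<in> V \<Longrightarrow> \<bar>re (h x x)\<bar> \<le> c * re (g x x)"
    and xy: "x \<in> V" "y \<in> V"
  shows "norm (h x y) \<le> c * sqrt (re (g x x)) * sqrt (re (g y y))"
proof -
  interpret h: hermitian_form h by fact
  interpret g: hermitian_form g by fact
  show ?thesis
  proof (cases "x = 0 \<or> y = 0")
    case False
    then have gx: "0 < re (g x x)" and gy: "0 < re (g y y)" using pos by auto
    have "0 \<le> c * re (g x x)" using le[OF xy(1)] by linarith
    with gx have c: "0 \<le> c" by (simp add: zero_le_mult_iff)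
    define a where "a = sqrt (re (g x x))"
    define b where "b = sqrt (re (g y y))"
    have ab: "0 < a" "0 < b" "re (g x x) = a\<^sup>2" "re (g y y) = b\<^sup>2"
      using gx gy by (auto simp: a_def b_def)
    show ?thesis
    proof (cases "h x y = 0")
      case True
      then show ?thesis using c gx gy by simp
    next
      case z: False
      define u where "u = conjg (h x y) / of_real (norm (h x y))"
      have uz: "u * h x y = of_real (norm (h x y))"
        using z mult_conjg[of "h x y"]
        by (simp add: u_def field_simps power2_eq_square)
      then have "norm u * norm (h x y) = norm (h x y)"
        by (simp flip: norm_mult)
      then have u: "norm u = 1" using z by simp
      \<comment> \<open>The factors are exchanged: \<open>x\<close> is scaled by the norm of
        \<open>y\<close> and vice versa, so both vectors have squared \<open>g\<close>-norm
        \<open>a\<^sup>2 * b\<^sup>2\<close>.\<close>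
      define s where "s = (of_real b * u) *s x"
      define t where "t = of_real a *s y"
      have "h s t = of_real (a * b * norm (h x y))"
        by (simp add: s_def t_def h.scale_left h.scale_right uz mult_ac)
      then have st: "re (h s t) = a * b * norm (h x y)" by (simp only: re_of_real)
      have gs: "re (g s s) = b\<^sup>2 * a\<^sup>2" and gt: "re (g t t) = a\<^sup>2 * b\<^sup>2"
        using ab u by (simp_all add: s_def t_def g.re_diag_scale norm_mult)
      have "s \<in> V" "t \<in> V"
        unfolding s_def t_def using V xy by (simp_all add: vec.subspace_scale)
      then have V': "s + t \<in> V" "s - t \<in> V"
        using V by (simp_all add: vec.subspace_add vec.subspace_diff)
      have "4 * (a * b * norm (h x y)) \<le> c * re (g (s + t) (s + t)) + c * re (g (s - t) (s - t))"
        using h.polarization[of s t] le[OF V'(1)] le[OF V'(2)] st by linarith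
      also have "\<dots> = c * (2 * (re (g s s) + re (g t t)))"
        by (simp only: g.parallelogram flip: distrib_left)
      finally have "(a * b) * norm (h x y) \<le> (a * b) * (c * a * b)"
        by (simp add: gs gt power2_eq_square algebra_simps)
      then have "norm (h x y) \<le> c * a * b" using ab by simp
      then show ?thesis by (simp add: a_def b_def)
    qed
  qed auto
qed

section \<open>The smallest embedding constant\<close>

text \<open>The quotient is continuous and homogeneous of degree 0, so a maximum on the compact unit
  sphere of \<open>V\<close> is a maximum over all nonzero vectors of \<open>V\<close>.\<close>

lemma hermitian_form_quotient_attains_max:
  assumes h: "hermitian_form h" and g: "hermitian_form g"
    and V: "vec.subspace V" "V \<noteq> {0}" and pos: "\<And>x. x \<noteq> 0 \<Longrightarrow> 0 < re (g x x)"
  obtains a c where "a \<in> V" "a \<noteq> 0" "\<bar>re (h a a)\<bar> = c * re (g a a)"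
    "\<And>x. x \<in> V \<Longrightarrow> \<bar>re (h x x)\<bar> \<le> c * re (g x x)"
proof -
  interpret h: hermitian_form h by fact
  interpret g: hermitian_form g by fact
  define f where "f x = \<bar>re (h x x)\<bar> / re (g x x)" for x
  let ?S = "V \<inter> sphere 0 1"
  have normalized: "of_real (inverse (norm x)) *s x \<in> ?S" if "x \<in> V" "x \<noteq> 0" for x
  proof -
    have "norm (of_real (inverse (norm x)) *s x) = 1"
      unfolding scaleR_eq_smult[symmetric] using that by simp
    then show ?thesis using V(1) that by (simp add: vec.subspace_scale del: of_real_inverse)
  qed
  have f_normalized: "f (of_real (inverse (norm x)) *s x) = f x" if "x \<noteq> 0" for x
    using that by (simp add: f_def h.re_diag_scale g.re_diag_scale abs_mult del: of_real_inverse)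
  obtain x0 where "x0 \<in> V" "x0 \<noteq> 0" using V vec.subspace_0 by blast
  then have ne: "?S \<noteq> {}" using normalized by blast
  have cpt: "compact ?S" using closed_vec_subspace[OF V(1)] by (simp add: closed_Int_compact)
  have nz: "re (g x x) \<noteq> 0" if "x \<in> ?S" for x
    using pos[of x] that by force
  have "continuous_on ?S f"
    unfolding f_def using nz
    by (intro continuous_intros h.continuous_on_diag g.continuous_on_diag) auto
  then obtain a where a: "a \<in> ?S" "\<forall>x\<in>?S. f x \<le> f a"
    using continuous_attains_sup[OF cpt ne] by blast
  show thesis
  proof
    show "a \<in> V" "a \<noteq> 0" using a(1) by auto
    show "\<bar>re (h a a)\<bar> = f a * re (g a a)" using nz[OF a(1)] by (simp add: f_def)
    show "\<bar>re (h x x)\<bar> \<le> f a * re (g x x)" if "x \<in> V" for x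
    proof (cases "x = 0")
      case False
      then have "f x \<le> f a" using a(2) normalized[OF that] f_normalized by metis
      then show ?thesis using pos[OF False] by (simp add: f_def pos_divide_le_eq)
    qed simp
  qed
qed

text \<open>Testing the pair \<open>(a, a)\<close> forces \<open>c \<le> \<epsilon>\<close>;
  conversely \<open>c\<close> bounds the diagonal, and \<open>hermitian_form_le\<close> extends the
  bound to all pairs. Both \<open>a\<close> and \<open>c\<close> are found without reference to any
  random matrix.\<close>

lemma subspace_embedding_iff_ge:
  fixes R :: "'k::real_or_complex ^ 'n ^ 'n" and \<Theta> :: "'k ^ 'n ^ 'm"
  assumes R: "hermitian R" "positive_definite R"
    and V: "vec.subspace V" "V \<noteq> {0}"
  obtains a c where "a \<in> V" "a \<noteq> 0"
    "\<bar>(normU R a)\<^sup>2 - (sketched_norm \<Theta> a)\<^sup>2\<bar> = c * (normU R a)\<^sup>2"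
    "\<And>\<epsilon>. subspace_embedding R \<Theta> \<epsilon> V \<longleftrightarrow> c \<le> \<epsilon>"
proof -
  let ?h = "\<lambda>x y. innerU R x y - sketched_inner \<Theta> x y"
  have g: "hermitian_form (innerU R)" by (rule hermitian_form_innerU[OF R(1)])
  have h: "hermitian_form ?h"
    by (intro hermitian_form_diff g hermitian_form_sketched_inner)
  have pos: "0 < re (innerU R x x)" if "x \<noteq> 0" for x
    using R(2) that by (simp add: positive_definite_def innerU_def)
  interpret g: hermitian_form "innerU R" by (rule g)
  have U: "re (innerU R x x) = (normU R x)\<^sup>2" for x
    using pos[of x] by (cases "x = 0") (auto simp: normU_def)
  obtain a c where a: "a \<in> V" "a \<noteq> 0" "\<bar>re (?h a a)\<bar> = c * re (innerU R a a)"
    "\<And>x. x \<in> V \<Longrightarrow> \<bar>re (?h x x)\<bar> \<le> c * re (innerU R x x)"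
    by (rule hermitian_form_quotient_attains_max[OF h g V pos]) blast+
  show thesis
  proof
    show "a \<in> V" "a \<noteq> 0" by fact+
    show "\<bar>(normU R a)\<^sup>2 - (sketched_norm \<Theta> a)\<^sup>2\<bar> = c * (normU R a)\<^sup>2"
      using a(3) by (simp add: re_diff re_sketched_inner U)
    show "subspace_embedding R \<Theta> \<epsilon> V \<longleftrightarrow> c \<le> \<epsilon>" for \<epsilon>
    proof
      assume "subspace_embedding R \<Theta> \<epsilon> V"
      then have "norm (?h a a) \<le> \<epsilon> * normU R a * normU R a"
        using a(1) by (simp add: subspace_embedding_def)
      then have "c * re (innerU R a a) \<le> \<epsilon> * re (innerU R a a)"
        using a(3) by (simp add: hermitian_form.norm_diag[OF h] U power2_eq_square mult.assoc)
      then show "c \<le> \<epsilon>" using pos[OF a(2)] by simp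
    next
      assume "c \<le> \<epsilon>"
      have "\<bar>re (?h x x)\<bar> \<le> \<epsilon> * re (innerU R x x)" if "x \<in> V" for x
      proof -
        have "c * re (innerU R x x) \<le> \<epsilon> * re (innerU R x x)"
          using \<open>c \<le> \<epsilon>\<close> by (intro mult_right_mono) (simp_all add: U)
        then show ?thesis using a(4)[OF that] by linarith
      qed
      then show "subspace_embedding R \<Theta> \<epsilon> V"
        unfolding subspace_embedding_def
        using hermitian_form_le[OF h g V(1) pos] by (simp add: normU_def)
    qed
  qed
qed

section \<open>Sublevel sets and measurability of \<open>omega_bar\<close>\<close>

text \<open>Since the extrema are attained, a bound on \<open>omega_bar\<close> is a pointwise
  condition; clearing the positive denominators makes it a family of closed conditions on
  \<open>\<Theta>s\<close>, apart from injectivity on \<open>V\<close>. It serves both for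
  measurability and for evaluation at one vector.\<close>

lemma omega_bar_le_iff:
  assumes V: "vec.subspace V" "V \<noteq> {0}" and \<epsilon>: "0 < \<epsilon>" "\<epsilon> < 1"
  shows "omega_bar \<epsilon> \<Theta> \<Theta>s V \<le> ereal c \<longleftrightarrow> (\<forall>x\<in>V - {0}. sketched_norm \<Theta>s x \<noteq> 0 \<and>
    (1 - c) * (sketched_norm \<Theta>s x)\<^sup>2 \<le> (1 - \<epsilon>) * (sketched_norm \<Theta> x)\<^sup>2 \<and>
    (1 + \<epsilon>) * (sketched_norm \<Theta> x)\<^sup>2 \<le> (1 + c) * (sketched_norm \<Theta>s x)\<^sup>2)"
proof (cases "\<exists>x\<in>V - {0}. sketched_norm \<Theta>s x = 0")
  case True
  then show ?thesis unfolding omega_bar_def by auto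
next
  case False
  define f where "f x = (sketched_norm \<Theta> x / sketched_norm \<Theta>s x)\<^sup>2" for x
  obtain a b where ab: "a \<in> V - {0}" "b \<in> V - {0}"
    "\<And>x. x \<in> V - {0} \<Longrightarrow> f a \<le> f x \<and> f x \<le> f b"
    "(INF x\<in>V - {0}. f x) = f a" "(SUP x\<in>V - {0}. f x) = f b"
    using ratio_attains[OF V, of \<Theta>s \<Theta>] False unfolding f_def by blast
  have "omega_bar \<epsilon> \<Theta> \<Theta>s V = ereal (max (1 - (1 - \<epsilon>) * f a) ((1 + \<epsilon>) * f b - 1))"
    unfolding omega_bar_def using False ab(4,5) by (simp add: f_def)
  then have "omega_bar \<epsilon> \<Theta> \<Theta>s V \<le> ereal c \<longleftrightarrow> 1 - c \<le> (1 - \<epsilon>) * f a \<and> (1 + \<epsilon>) * f b \<le> 1 + c"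
    by auto
  \<comment> \<open>The factors \<open>1 - \<epsilon>\<close> and \<open>1 + \<epsilon>\<close> are
    nonnegative, so the conditions at the minimizer \<open>a\<close> and the maximizer
    \<open>b\<close> carry over to every \<open>x\<close>.\<close>
  also have "\<dots> \<longleftrightarrow> (\<forall>x\<in>V - {0}. 1 - c \<le> (1 - \<epsilon>) * f x \<and> (1 + \<epsilon>) * f x \<le> 1 + c)"
  proof -
    have "(1 - \<epsilon>) * f a \<le> (1 - \<epsilon>) * f x" "(1 + \<epsilon>) * f x \<le> (1 + \<epsilon>) * f b" if "x \<in> V - {0}" for x
      using ab(3)[OF that] \<epsilon> by (simp_all add: mult_left_mono)
    then show ?thesis using ab(1,2) by (meson order_trans)
  qed
  also have "\<dots> \<longleftrightarrow> (\<forall>x\<in>V - {0}. sketched_norm \<Theta>s x \<noteq> 0 \<and>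
    (1 - c) * (sketched_norm \<Theta>s x)\<^sup>2 \<le> (1 - \<epsilon>) * (sketched_norm \<Theta> x)\<^sup>2 \<and>
    (1 + \<epsilon>) * (sketched_norm \<Theta> x)\<^sup>2 \<le> (1 + c) * (sketched_norm \<Theta>s x)\<^sup>2)"
  proof (rule ball_cong[OF refl])
    fix x assume "x \<in> V - {0}"
    then have nz: "sketched_norm \<Theta>s x \<noteq> 0" using False by blast
    then have "0 < (sketched_norm \<Theta>s x)\<^sup>2" by simp
    with nz show "1 - c \<le> (1 - \<epsilon>) * f x \<and> (1 + \<epsilon>) * f x \<le> 1 + c \<longleftrightarrow> sketched_norm \<Theta>s x \<noteq> 0 \<and>
      (1 - c) * (sketched_norm \<Theta>s x)\<^sup>2 \<le> (1 - \<epsilon>) * (sketched_norm \<Theta> x)\<^sup>2 \<and>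
      (1 + \<epsilon>) * (sketched_norm \<Theta> x)\<^sup>2 \<le> (1 + c) * (sketched_norm \<Theta>s x)\<^sup>2"
      by (simp add: f_def power_divide pos_le_divide_eq pos_divide_le_eq)
  qed
  finally show ?thesis .
qed

text \<open>Together with \<open>omega_bar < 1\<close> this makes the value finite, so that
  \<open>real_of_ereal\<close> never returns its default 0 for an infinite value.\<close>

lemma omega_bar_neq_MInf: "omega_bar \<epsilon> \<Theta> \<Theta>s V \<noteq> - \<infinity>"
  unfolding omega_bar_def by (simp del: ereal_max)

lemma continuous_on_sketched_norm: "continuous_on S (\<lambda>A. sketched_norm A x)"
  unfolding sketched_norm_eq matrix_vector_mult_def
  by (intro continuous_intros continuous_on_vec_lambda)

text \<open>
  By compactness of the unit sphere, injectivity on \<open>V\<close> amounts to a uniform lower bound there,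
  which exhibits the set as a countable union of closed sets.
\<close>

lemma borel_injective_on_subspace:
  assumes V: "vec.subspace V"
  shows "{A :: 'k::real_or_complex ^ 'n ^ 's. \<forall>x\<in>V - {0}. sketched_norm A x \<noteq> 0} \<in> sets borel"
proof -
  let ?S = "V \<inter> sphere 0 1"
  have cpt: "compact ?S" using closed_vec_subspace[OF V] by (simp add: closed_Int_compact)
  have "(\<forall>x\<in>V - {0}. sketched_norm A x \<noteq> 0) \<longleftrightarrow>
      (\<exists>n. \<forall>x\<in>?S. inverse (real (Suc n)) \<le> sketched_norm A x)" for A :: "'k ^ 'n ^ 's"
  proof
    assume nz: "\<forall>x\<in>V - {0}. sketched_norm A x \<noteq> 0"
    show "\<exists>n. \<forall>x\<in>?S. inverse (real (Suc n)) \<le> sketched_norm A x"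
    proof (cases "?S = {}")
      case False
      have "continuous_on ?S (\<lambda>x. sketched_norm A x)"
        unfolding sketched_norm_eq
        by (intro continuous_intros continuous_on_matrix_vector_mult)
      then obtain a where a: "a \<in> ?S" "\<forall>x\<in>?S. sketched_norm A a \<le> sketched_norm A x"
        using continuous_attains_inf[OF cpt False] by blast
      then have "a \<in> V - {0}" by auto
      then have "sketched_norm A a \<noteq> 0" using nz by blast
      then have "0 < sketched_norm A a" by (simp add: sketched_norm_eq)
      then obtain n where "inverse (real (Suc n)) < sketched_norm A a"
        using reals_Archimedean by blast
      then show ?thesis using a(2) by (meson less_imp_le order_trans)
    qed simp
  next
    assume "\<exists>n. \<forall>x\<in>?S. inverse (real (Suc n)) \<le> sketched_norm A x"
    then obtain n where n: "\<forall>x\<in>?S. inverse (real (Suc n)) \<le> sketched_norm A x" ..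
    show "\<forall>x\<in>V - {0}. sketched_norm A x \<noteq> 0"
    proof
      fix x assume x: "x \<in> V - {0}"
      let ?y = "of_real (inverse (norm x)) *s x"
      have "norm ?y = 1" unfolding scaleR_eq_smult[symmetric] using x by simp
      moreover have "?y \<in> V" using V x by (simp add: vec.subspace_scale del: of_real_inverse)
      ultimately have "inverse (real (Suc n)) \<le> sketched_norm A ?y" using n by simp
      moreover have "0 < inverse (real (Suc n))" by simp
      ultimately have "sketched_norm A ?y > 0" by linarith
      then show "sketched_norm A x \<noteq> 0"
        by (auto simp: sketched_norm_eq vector_scalar_commute)
    qed
  qed
  then have "{A :: 'k ^ 'n ^ 's. \<forall>x\<in>V - {0}. sketched_norm A x \<noteq> 0} =
      (\<Union>n. \<Inter>x\<in>?S. {A. inverse (real (Suc n)) \<le> sketched_norm A x})"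
    by auto
  also have "\<dots> \<in> sets borel"
    by (intro sets.countable_UN image_subsetI borel_closed closed_INT ballI closed_Collect_le
        continuous_on_sketched_norm continuous_on_const)
  finally show ?thesis .
qed

text \<open>The family of conditions over \<open>V - {0}\<close> may be uncountable, but all of them
  are closed, so their intersection is closed; the injectivity condition is Borel by the preceding
  lemma.\<close>

lemma borel_measurable_omega_bar:
  assumes V: "vec.subspace V" "V \<noteq> {0}" and \<epsilon>: "0 < \<epsilon>" "\<epsilon> < 1"
  shows "(\<lambda>A :: 'k::real_or_complex ^ 'n ^ 's. omega_bar \<epsilon> \<Theta> A V) \<in> borel_measurable borel"
  unfolding borel_measurable_iff_Iic_ereal
proof
  fix e :: ereal
  show "(\<lambda>A :: 'k ^ 'n ^ 's. omega_bar \<epsilon> \<Theta> A V) -` {..e} \<inter> space borel \<in> sets borel"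
  proof (cases e)
    case (real c)
    let ?C = "\<Inter>x\<in>V - {0}.
      {A :: 'k ^ 'n ^ 's. (1 - c) * (sketched_norm A x)\<^sup>2 \<le> (1 - \<epsilon>) * (sketched_norm \<Theta> x)\<^sup>2} \<inter>
      {A. (1 + \<epsilon>) * (sketched_norm \<Theta> x)\<^sup>2 \<le> (1 + c) * (sketched_norm A x)\<^sup>2}"
    have "(\<lambda>A :: 'k ^ 'n ^ 's. omega_bar \<epsilon> \<Theta> A V) -` {..e} \<inter> space borel =
        {A. \<forall>x\<in>V - {0}. sketched_norm A x \<noteq> 0} \<inter> ?C"
      unfolding real by (auto simp: omega_bar_le_iff[OF V \<epsilon>])
    moreover have C: "closed ?C"
      by (intro closed_INT ballI closed_Int closed_Collect_le continuous_intros
          continuous_on_sketched_norm)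
    moreover note sets.Int[OF borel_injective_on_subspace[OF V(1)] borel_closed[OF C]]
    ultimately show ?thesis by (simp only:)
  next
    case PInf
    then show ?thesis by (simp add: vimage_def)
  next
    case MInf
    then show ?thesis by (simp add: vimage_def omega_bar_neq_MInf)
  qed
qed

section \<open>The probability estimate\<close>

theorem proposition5p3:
  fixes R :: "'k::real_or_complex ^ 'n ^ 'n"
    and V :: "('k ^ 'n) set"
    and \<Theta> :: "'k ^ 'n ^ 'm"
    and M :: "'w measure"
    and \<Theta>s :: "'w \<Rightarrow> 'k ^ 'n ^ 's"
    and \<epsilon>s \<delta>s :: real
  assumes "hermitian R" and "positive_definite R"
    and "vec.subspace V" and "V \<noteq> {0}"
    and "0 < \<epsilon>s" and "\<epsilon>s < 1" and "0 < \<delta>s" and "\<delta>s < 1"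
    and "prob_space M" and "\<Theta>s \<in> borel_measurable M"
    and "\<And>x y. x \<in> V \<Longrightarrow> y \<in> V \<Longrightarrow>
      measure M {w \<in> space M. norm (innerU R x y - sketched_inner (\<Theta>s w) x y)
          \<le> \<epsilon>s * normU R x * normU R y} \<ge> 1 - \<delta>s"
  shows "measure M {w \<in> space M. omega_bar \<epsilon>s \<Theta> (\<Theta>s w) V < 1 \<longrightarrow>
      subspace_embedding R \<Theta> (real_of_ereal (omega_bar \<epsilon>s \<Theta> (\<Theta>s w) V)) V} \<ge> 1 - \<delta>s"
proof -
  interpret prob_space M by fact
  note V = assms(3,4) and \<epsilon>s = assms(5,6)
  let ?\<omega> = "\<lambda>w. omega_bar \<epsilon>s \<Theta> (\<Theta>s w) V"
  obtain a c where a: "a \<in> V" "a \<noteq> 0"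
    "\<bar>(normU R a)\<^sup>2 - (sketched_norm \<Theta> a)\<^sup>2\<bar> = c * (normU R a)\<^sup>2"
    and emb: "\<And>\<epsilon>. subspace_embedding R \<Theta> \<epsilon> V \<longleftrightarrow> c \<le> \<epsilon>"
    by (rule subspace_embedding_iff_ge[OF assms(1-4), of \<Theta>]) blast
  \<comment> \<open>The embedding property becomes a comparison of \<open>?\<omega>\<close> with the
    fixed number \<open>c\<close>, which is visibly measurable. For infinite
    \<open>?\<omega> w\<close> both implications hold vacuously.\<close>
  have event: "(?\<omega> w < 1 \<longrightarrow> subspace_embedding R \<Theta> (real_of_ereal (?\<omega> w)) V) \<longleftrightarrow>
      (?\<omega> w < 1 \<longrightarrow> ereal c \<le> ?\<omega> w)" for w
    using omega_bar_neq_MInf[of \<epsilon>s \<Theta> "\<Theta>s w" V] by (cases "?\<omega> w") (auto simp: emb)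
  have meas: "?\<omega> \<in> borel_measurable M"
    by (rule measurable_compose[OF assms(10) borel_measurable_omega_bar[OF V \<epsilon>s]])
  let ?E = "{w \<in> space M. norm (innerU R a a - sketched_inner (\<Theta>s w) a a)
    \<le> \<epsilon>s * normU R a * normU R a}"
  let ?B = "{w \<in> space M. ?\<omega> w < 1 \<longrightarrow> ereal c \<le> ?\<omega> w}"
  have posU: "0 < re (innerU R a a)"
    using assms(2) a(2) by (simp add: positive_definite_def innerU_def)
  then have U: "re (innerU R a a) = (normU R a)\<^sup>2" and Upos: "0 < (normU R a)\<^sup>2"
    by (simp_all add: normU_def)
  have "?E \<subseteq> ?B"
  proof safe
    fix w assume E: "norm (innerU R a a - sketched_inner (\<Theta>s w) a a) \<le> \<epsilon>s * normU R a * normU R a"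
      and lt: "?\<omega> w < 1"
    obtain r where r: "?\<omega> w = ereal r"
      using lt omega_bar_neq_MInf[of \<epsilon>s \<Theta> "\<Theta>s w" V] by (cases "?\<omega> w") auto
    with lt have r1: "r < 1" by simp
    have le: "(1 - r) * (sketched_norm (\<Theta>s w) a)\<^sup>2 \<le> (1 - \<epsilon>s) * (sketched_norm \<Theta> a)\<^sup>2"
      "(1 + \<epsilon>s) * (sketched_norm \<Theta> a)\<^sup>2 \<le> (1 + r) * (sketched_norm (\<Theta>s w) a)\<^sup>2"
      using omega_bar_le_iff[OF V \<epsilon>s, of \<Theta> "\<Theta>s w" r] r a(1,2) by auto
    have "hermitian_form (\<lambda>x y. innerU R x y - sketched_inner (\<Theta>s w) x y)"
      by (intro hermitian_form_diff hermitian_form_innerU hermitian_form_sketched_inner assms)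
    from hermitian_form.norm_diag[OF this, of a] E
    have "\<bar>(normU R a)\<^sup>2 - (sketched_norm (\<Theta>s w) a)\<^sup>2\<bar> \<le> \<epsilon>s * (normU R a)\<^sup>2"
      by (simp add: re_diff re_sketched_inner U power2_eq_square mult.assoc)
    then have s: "(1 - \<epsilon>s) * (normU R a)\<^sup>2 \<le> (sketched_norm (\<Theta>s w) a)\<^sup>2"
      "(sketched_norm (\<Theta>s w) a)\<^sup>2 \<le> (1 + \<epsilon>s) * (normU R a)\<^sup>2"
      by (auto simp: algebra_simps abs_le_iff)
    \<comment> \<open>Here \<open>?\<omega> w < 1\<close> enters: it makes the factor
      \<open>1 - r\<close> positive.\<close>
    have "(1 - r) * ((1 - \<epsilon>s) * (normU R a)\<^sup>2) \<le> (1 - r) * (sketched_norm (\<Theta>s w) a)\<^sup>2"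
      using s(1) r1 by (intro mult_left_mono) auto
    also note le(1)
    finally have "(1 - \<epsilon>s) * ((1 - r) * (normU R a)\<^sup>2) \<le> (1 - \<epsilon>s) * (sketched_norm \<Theta> a)\<^sup>2"
      by (subst mult.left_commute)
    then have lower: "(1 - r) * (normU R a)\<^sup>2 \<le> (sketched_norm \<Theta> a)\<^sup>2"
      using \<epsilon>s by simp
    \<comment> \<open>The sign of \<open>1 + r\<close> is needed to multiply the upper bound
      \<open>s(2)\<close>; it follows from \<open>le(2)\<close> because the sketched norm of
      \<open>a\<close> is positive.\<close>
    have "0 \<le> (1 + r) * (sketched_norm (\<Theta>s w) a)\<^sup>2"
      using le(2) \<epsilon>s by (smt (verit) mult_nonneg_nonneg zero_le_power2)
    moreover have "0 < (sketched_norm (\<Theta>s w) a)\<^sup>2"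
      using s(1) \<epsilon>s Upos by (smt (verit) mult_pos_pos)
    ultimately have "0 \<le> 1 + r" by (simp add: zero_le_mult_iff)
    then have "(1 + \<epsilon>s) * (sketched_norm \<Theta> a)\<^sup>2 \<le> (1 + \<epsilon>s) * ((1 + r) * (normU R a)\<^sup>2)"
      using mult_left_mono[OF s(2), of "1 + r"] le(2) by (simp add: mult_ac)
    then have upper: "(sketched_norm \<Theta> a)\<^sup>2 \<le> (1 + r) * (normU R a)\<^sup>2"
      using \<epsilon>s by simp
    \<comment> \<open>The two bounds put the squared sketched norm of \<open>a\<close> within
      \<open>r * (normU R a)\<^sup>2\<close> of its true value, and at \<open>a\<close> this
      deviation is exactly \<open>c * (normU R a)\<^sup>2\<close>.\<close>
    have "c * (normU R a)\<^sup>2 \<le> r * (normU R a)\<^sup>2"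
      using lower upper unfolding a(3)[symmetric] by (auto simp: algebra_simps abs_le_iff)
    then show "ereal c \<le> ?\<omega> w" using Upos by (simp add: r)
  qed
  \<comment> \<open>Monotonicity asks for the larger set to be measurable; \<open>measure\<close>
    would assign 0 to a nonmeasurable one.\<close>
  moreover have "?B \<in> sets M" using meas by measurable
  ultimately have "measure M ?E \<le> measure M ?B" by (rule finite_measure_mono)
  with assms(11)[OF a(1) a(1)] show ?thesis unfolding event by (rule order_trans)
qed

end
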